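(* Let $K/k$ be a purely inseparable extension of finite exponent, of characteristic $p>0$, and let $L$ be an intermediate field, $k\subseteq L\subseteq K$. Then for every $r$-base $B_L$ of $L/k$ and every $r$-base $B_K$ of $K/k$, one has $|B_L|\le |B_K|$.
   Context: All fields are commutative of characteristic $p>0$. A purely inseparable extension $K/k$ has finite exponent if there is $e\in\mathbb N$ with $K^{p^e}\subseteq k$. A subset $B\subseteq K$ is an $r$-base of $K/k$ if $K=k(K^p)(B)$ and, for every $x\in B$, $x\notin k(K^p)(B\setminus\{x\})$. $|\cdot|$ denotes cardinality. *)

theory Defs
  imports "HOL-Algebra.Algebra"
begin

unbundle cardinal_syntax

text \<open>The additive order of \<open>\<one>\<close>; by the convention of \<^const>\<open>group.ord\<close> it is \<open>0\<close> if that order is infinite.\<close>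

definition ring_char :: "('a, 'b) ring_scheme \<Rightarrow> nat"
  where "ring_char R = group.ord (add_monoid R) \<one>\<^bsub>R\<^esub>"

text \<open>
  A field extension \<open>K/k\<close> is given by a field \<open>K\<close> together with a subfield
  \<open>k\<close> of \<open>K\<close> (a subset of the carrier). For an intermediate field with carrier \<open>L\<close>,
  the extension \<open>L/k\<close> is given by \<open>K\<lparr>carrier := L\<rparr>\<close> and \<open>k\<close>.
\<close>

definition purely_inseparable :: "('a, 'b) ring_scheme \<Rightarrow> 'a set \<Rightarrow> bool"
  where "purely_inseparable K k \<longleftrightarrow>
    (\<forall>x \<in> carrier K. \<exists>n::nat. x [^]\<^bsub>K\<^esub> (ring_char K ^ n) \<in> k)"

definition power_image :: "('a, 'b) ring_scheme \<Rightarrow> nat \<Rightarrow> 'a set"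
  where "power_image K n = (\<lambda>x. x [^]\<^bsub>K\<^esub> n) ` carrier K"

definition finite_exponent :: "('a, 'b) ring_scheme \<Rightarrow> 'a set \<Rightarrow> bool"
  where "finite_exponent K k \<longleftrightarrow> (\<exists>e::nat. power_image K (ring_char K ^ e) \<subseteq> k)"

definition adjoin :: "('a, 'b) ring_scheme \<Rightarrow> 'a set \<Rightarrow> 'a set \<Rightarrow> 'a set"
  where "adjoin K k S = generate_field K (k \<union> S)"

definition r_base :: "('a, 'b) ring_scheme \<Rightarrow> 'a set \<Rightarrow> 'a set \<Rightarrow> bool"
  where "r_base K k B \<longleftrightarrow>
    B \<subseteq> carrier K \<and>
    carrier K = adjoin K (adjoin K k (power_image K (ring_char K))) B \<and>
    (\<forall>x \<in> B. x \<notin> adjoin K (adjoin K k (power_image K (ring_char K))) (B - {x}))"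

end

theory Submission
  imports Defs
begin

text \<open>
  For subfields \<open>k \<subseteq> L\<close> the operator \<open>S \<mapsto> k(L\<^sup>p)(S)\<close> on subsets of \<open>L\<close> is the closure operator of a matroid,
  and an \<open>r\<close>-base of \<open>L/k\<close> is a basis of it. The matroid exchange axiom (\<open>pth_root_exchange\<close>) is
  the field-theoretic input: adjoining a \<open>p\<close>-th root not already present is an extension of
  prime degree \<open>p\<close>, so it has no proper intermediate field.

  The ranks of the matroids of \<open>L\<close> and of \<open>K\<close> have to be compared, although independence over \<open>k(L\<^sup>p)\<close> does not
  imply independence over \<open>k(K\<^sup>p)\<close>. For one step \<open>M = L(x)\<close> with \<open>x\<^sup>p \<in> L\<close> and \<open>x \<notin> L\<close>, the
  ground field grows by at most the element \<open>x\<^sup>p\<close>, which destroys at most one element of an independent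
  set, and the new element \<open>x\<close> can replace it (\<open>carries_adjoin_pth_root\<close>). So the rank does not drop
  along such a step, nor along the finite towers of such steps that lead from \<open>L\<close> to \<open>L(S)\<close> for a
  finite set \<open>S\<close>.

  Finite exponent implies that an \<open>r\<close>-base \<open>B\<close> of \<open>K/k\<close> generates \<open>K\<close> over \<open>k\<close>
  (\<open>generated_by_r_generators\<close>). If \<open>B\<close> is finite, the tower argument with \<open>S = B\<close> reaches \<open>K\<close>, and Steinitz'
  comparison of independent with generating sets
  (\<open>r_independent_card_le_generators\<close>) finishes the proof. If \<open>B\<close> is infinite, the finite case bounds the part of
  an \<open>r\<close>-base of \<open>L/k\<close> inside \<open>k(S)\<close> for each finite \<open>S \<subseteq> B\<close>, and these parts are indexed by the finite
  subsets of \<open>B\<close>, of which there are \<open>|B|\<close>.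
\<close>

section \<open>The Frobenius endomorphism\<close>

lemma (in cring) binomial_expansion:
  assumes a: "a \<in> carrier R" and b: "b \<in> carrier R"
  shows "(a \<oplus> b) [^] (n::nat) = (\<Oplus>k\<in>{..n}. add_pow R (n choose k) (a [^] k \<otimes> b [^] (n - k)))"
proof (induction n)
  case 0
  show ?case using a b by simp
next
  case (Suc n)
  let ?t = "\<lambda>n k. add_pow R (n choose k) (a [^] k \<otimes> b [^] (n - k))"
  let ?u = "\<lambda>k. add_pow R (n choose k) (a [^] Suc k \<otimes> b [^] (n - k))"
  let ?v = "\<lambda>k. add_pow R (n choose k) (a [^] k \<otimes> b [^] (Suc n - k))"
  have tc: "?t m k \<in> carrier R" and uc: "?u k \<in> carrier R" and vc: "?v k \<in> carrier R" for m k
    using a b by auto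
  have A: "(\<Oplus>k\<in>{..n}. ?t n k) \<otimes> a = (\<Oplus>k\<in>{..n}. ?u k)"
  proof -
    have "?t n k \<otimes> a = ?u k" for k
      using a b by (simp add: add_pow_ldistr add_pow_rdistr m_ac)
    then show ?thesis using tc a by (simp add: finsum_ldistr)
  qed
  have B: "(\<Oplus>k\<in>{..n}. ?t n k) \<otimes> b = (\<Oplus>k\<in>{..n}. ?v k)"
  proof -
    have "?t n k \<otimes> b = ?v k" if "k \<le> n" for k
      using a b that by (simp add: add_pow_ldistr add_pow_rdistr m_ac Suc_diff_le)
    then have "(\<Oplus>k\<in>{..n}. ?t n k \<otimes> b) = (\<Oplus>k\<in>{..n}. ?v k)"
      using vc by (intro finsum_cong') auto
    then show ?thesis using tc b by (simp add: finsum_ldistr)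
  qed
  \<comment> \<open>The term \<open>?v (Suc n)\<close> vanishes, so the sum may be extended to it and then shifted by one.\<close>
  have v': "(\<Oplus>k\<in>{..n}. ?v k) = (\<Oplus>k\<in>{..n}. ?v (Suc k)) \<oplus> ?v 0"
  proof -
    have "(\<Oplus>k\<in>{..Suc n}. ?v k) = ?v (Suc n) \<oplus> (\<Oplus>k\<in>{..n}. ?v k)"
      using vc by (intro finsum_Suc) auto
    moreover have "(\<Oplus>k\<in>{..Suc n}. ?v k) = (\<Oplus>k\<in>{..n}. ?v (Suc k)) \<oplus> ?v 0"
      using vc by (intro finsum_Suc2) auto
    moreover have "?v (Suc n) = \<zero>" using a b by (simp add: binomial_eq_0)
    moreover have "(\<Oplus>k\<in>{..n}. ?v k) \<in> carrier R" using vc by (intro finsum_closed) auto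
    ultimately show ?thesis by simp
  qed
  have w: "?t (Suc n) (Suc k) = ?u k \<oplus> ?v (Suc k)" for k
    using a b by (simp add: add.nat_pow_mult[symmetric])
  have "(\<Oplus>k\<in>{..Suc n}. ?t (Suc n) k) = (\<Oplus>k\<in>{..n}. ?t (Suc n) (Suc k)) \<oplus> ?t (Suc n) 0"
    using tc by (intro finsum_Suc2) auto
  also have "(\<Oplus>k\<in>{..n}. ?t (Suc n) (Suc k)) = (\<Oplus>k\<in>{..n}. ?u k \<oplus> ?v (Suc k))"
    by (simp only: w)
  also have "\<dots> = (\<Oplus>k\<in>{..n}. ?u k) \<oplus> (\<Oplus>k\<in>{..n}. ?v (Suc k))"
    using a b by (intro finsum_addf) auto
  finally have "(\<Oplus>k\<in>{..Suc n}. ?t (Suc n) k) =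
      (\<Oplus>k\<in>{..n}. ?u k) \<oplus> ((\<Oplus>k\<in>{..n}. ?v (Suc k)) \<oplus> ?v 0)"
    using uc vc a b by (simp add: a_assoc finsum_closed Pi_def)
  also have "\<dots> = (a \<oplus> b) [^] n \<otimes> (a \<oplus> b)"
    unfolding v'[symmetric] A[symmetric] B[symmetric] Suc.IH
    using tc a b by (simp add: r_distr finsum_closed Pi_def)
  finally show ?case by simp
qed

lemma (in cring) add_pow_eq_zero:
  assumes "add_pow R (p::nat) \<one> = \<zero>" "p dvd m" "z \<in> carrier R"
  shows "add_pow R (m::nat) z = \<zero>"
proof -
  obtain q where q: "m = p * q" using assms(2) by blast
  have "add_pow R m \<one> = \<zero>" 
    using assms(1) unfolding q by (simp flip: add.nat_pow_pow)
  then show ?thesis using add_pow_ldistr[of \<one> z m] assms(3) by simp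
qed

lemma (in cring) frobenius_add:
  assumes p: "Factorial_Ring.prime (p::nat)" and char: "add_pow R p \<one> = \<zero>"
    and a: "a \<in> carrier R" and b: "b \<in> carrier R"
  shows "(a \<oplus> b) [^] p = a [^] p \<oplus> b [^] p"
proof -
  obtain r where r: "p = Suc (Suc r)"
    using prime_ge_2_nat[OF p] by (metis One_nat_def Suc_1 add_2_eq_Suc le_Suc_ex)
  let ?t = "\<lambda>k. add_pow R (p choose k) (a [^] k \<otimes> b [^] (p - k))"
  have tc: "?t k \<in> carrier R" for k using a b by auto
  have z: "?t (Suc k) = \<zero>" if "k \<le> r" for k
  proof -
    have "p dvd (p choose Suc k)" using that p unfolding r by (intro dvd_choose_prime) auto
    then show ?thesis using add_pow_eq_zero[OF char] a b by auto
  qed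
  have "(\<Oplus>k\<in>{..p}. ?t k) = ?t p \<oplus> (\<Oplus>k\<in>{..Suc r}. ?t k)"
    unfolding r using tc by (intro finsum_Suc) (auto simp: r)
  also have "(\<Oplus>k\<in>{..Suc r}. ?t k) = (\<Oplus>k\<in>{..r}. ?t (Suc k)) \<oplus> ?t 0"
    using tc by (intro finsum_Suc2) auto
  also have "(\<Oplus>k\<in>{..r}. ?t (Suc k)) = (\<Oplus>k\<in>{..r}. \<zero>)"
    using z by (intro finsum_cong') auto
  finally show ?thesis unfolding binomial_expansion[OF a b] using a b by simp
qed

text \<open>
  Powers with exponent \<open>p ^ n\<close> are ring endomorphisms. This is what turns preimages of subfields under
  such a power map into subfields (\<open>subfield_roots\<close> below), so that a statement about the
  \<open>p ^ n\<close>-th powers of all elements of a generated field can be checked on generators.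
\<close>

lemma (in cring) frobenius_hom:
  assumes p: "Factorial_Ring.prime (p::nat)" and char: "add_pow R p \<one> = \<zero>"
  shows "ring_hom_ring R R (\<lambda>x. x [^] (p ^ n))"
proof -
  have add: "(x \<oplus> y) [^] (p ^ n) = x [^] (p ^ n) \<oplus> y [^] (p ^ n)"
    if "x \<in> carrier R" "y \<in> carrier R" for x y
  proof (induction n)
    case (Suc n)
    have "(x \<oplus> y) [^] (p ^ Suc n) = ((x \<oplus> y) [^] (p ^ n)) [^] p"
      using that by (simp add: nat_pow_pow mult.commute)
    also have "\<dots> = (x [^] (p ^ n)) [^] p \<oplus> (y [^] (p ^ n)) [^] p"
      unfolding Suc using that by (intro frobenius_add[OF p char]) auto
    finally show ?case using that by (simp add: nat_pow_pow mult.commute)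
  qed (use that in simp)
  show ?thesis
    by (intro ring_hom_ringI) (auto simp: add nat_pow_distrib ring_axioms)
qed

section \<open>The degree of a p-th root\<close>

lemma (in domain) nat_pow_nonzero:
  assumes "x \<in> carrier R" "x \<noteq> \<zero>"
  shows "x [^] (n::nat) \<noteq> \<zero>"
  using assms by (induction n) (auto simp: integral_iff)

text \<open>
  A divisor of \<open>(X - x)\<^sup>n\<close> is \<open>c (X - x)\<^sup>m\<close> because \<open>X - x\<close> is prime in the polynomial ring. Only the constant
  term of such a divisor is recorded, since it is the coefficient through which a power \<open>x\<^sup>m\<close> with
  \<open>m < p\<close> will be forced into a smaller field.
\<close>

lemma (in field) const_term_divisor_of_linear_power:
  assumes x: "x \<in> carrier R"
    and "f \<in> carrier (poly_ring R)" "g \<in> carrier (poly_ring R)"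
    and "f \<otimes>\<^bsub>poly_ring R\<^esub> g = [\<one>, \<ominus> x] [^]\<^bsub>poly_ring R\<^esub> (n::nat)"
  shows "const_term f = lead_coeff f \<otimes> (\<ominus> x) [^] degree f"
  using assms(2-)
proof (induction n arbitrary: f g)
  case 0
  interpret UP: domain "poly_ring R"
    using univ_poly_is_domain[OF carrier_is_subring] .
  have "f \<in> Units (poly_ring R)"
    using 0 UP.Units_one_closed by (metis UP.nat_pow_0 UP.unit_factor)
  then obtain k where "f = [k]" "k \<in> carrier R"
    unfolding univ_poly_carrier_units by auto
  then show ?case by (simp add: const_term_def)
next
  case (Suc n)
  interpret UP: domain "poly_ring R"
    using univ_poly_is_domain[OF carrier_is_subring] .
  let ?P = "poly_ring R" and ?l = "[\<one>, \<ominus> x]"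
  have l: "?l \<in> carrier ?P"
    using x unfolding univ_poly_carrier[symmetric] polynomial_def by auto
  have l0: "?l \<noteq> \<zero>\<^bsub>?P\<^esub>" unfolding univ_poly_zero by simp
  have l_prime: "pprime (carrier R) ?l"
    using pprime_iff_pirreducible[OF carrier_is_subfield l]
      degree_one_imp_pirreducible[OF carrier_is_subfield l] by simp
  have eq: "f \<otimes>\<^bsub>?P\<^esub> g = ?l \<otimes>\<^bsub>?P\<^esub> ?l [^]\<^bsub>?P\<^esub> n"
    using Suc.prems(3) l by (simp add: UP.m_comm)
  have "?l pdivides f \<otimes>\<^bsub>?P\<^esub> g"
    unfolding eq pdivides_def using l by (intro dividesI[of "?l [^]\<^bsub>?P\<^esub> n"]) auto
  then consider "?l pdivides f" | "?l pdivides g"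
    using pprimeE(3)[OF carrier_is_subfield l l_prime Suc.prems(1,2)] by blast
  then show ?case
  proof cases
    case 1
    then obtain h where h: "h \<in> carrier ?P" "f = ?l \<otimes>\<^bsub>?P\<^esub> h"
      unfolding pdivides_def factor_def by auto
    have "?l \<otimes>\<^bsub>?P\<^esub> (h \<otimes>\<^bsub>?P\<^esub> g) = ?l \<otimes>\<^bsub>?P\<^esub> ?l [^]\<^bsub>?P\<^esub> n"
      using eq h l Suc.prems(2) by (simp add: UP.m_assoc)
    then have hg: "h \<otimes>\<^bsub>?P\<^esub> g = ?l [^]\<^bsub>?P\<^esub> n"
      using UP.m_lcancel[OF l0 l] h(1) l Suc.prems(2) by auto
    have "h \<noteq> \<zero>\<^bsub>?P\<^esub>"
      using hg Suc.prems(2) UP.nat_pow_nonzero[OF l l0, of n] by auto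
    then have h0: "h \<noteq> []" unfolding univ_poly_zero .
    note IH = Suc.IH[OF h(1) Suc.prems(2) hg]
    have pl: "polynomial (carrier R) ?l" and ph: "polynomial (carrier R) h"
      using l h(1) unfolding univ_poly_carrier by auto
    have "degree f = Suc (degree h)"
      unfolding h(2) univ_poly_mult using poly_mult_degree_eq[OF carrier_is_subring pl ph] h0 by simp
    moreover have "lead_coeff f = lead_coeff h"
      unfolding h(2) univ_poly_mult 
      using poly_mult_lead_coeff[OF carrier_is_subring pl ph _ h0] lead_coeff_in_carrier ph h0
      by (metis Diff_iff carrier_is_subring l_one list.collapse list.discI list.sel(1))
    moreover have "const_term f = \<ominus> x \<otimes> const_term h"
      unfolding h(2) using const_term_simprules_shell(2)[OF carrier_is_subring l h(1)] x
      by (simp add: const_term_def)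
    moreover have "lead_coeff h \<in> carrier R"
      using ph h0 polynomial_incl by (metis hd_in_set subsetD)
    ultimately show ?thesis using IH x by (simp add: m_ac)
  next
    case 2
    then obtain h where h: "h \<in> carrier ?P" "g = ?l \<otimes>\<^bsub>?P\<^esub> h"
      unfolding pdivides_def factor_def by auto
    have "?l \<otimes>\<^bsub>?P\<^esub> (f \<otimes>\<^bsub>?P\<^esub> h) = ?l \<otimes>\<^bsub>?P\<^esub> ?l [^]\<^bsub>?P\<^esub> n"
      using eq h l Suc.prems(1) by (simp add: UP.m_lcomm)
    then have "f \<otimes>\<^bsub>?P\<^esub> h = ?l [^]\<^bsub>?P\<^esub> n"
      using UP.m_lcancel[OF l0 l] h(1) l Suc.prems(1) by auto
    then show ?thesis using Suc.IH Suc.prems(1) h(1) by blast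
  qed
qed

lemma (in field) subfield_nat_pow:
  assumes "subfield F R" "x \<in> F"
  shows "x [^] (n::nat) \<in> F"
  using assms subringE(3,6)[OF subfieldE(1)[OF assms(1)]] by (induction n) auto

lemma (in field) subfield_coprime_powers:
  assumes F: "subfield F R" and x: "x \<in> carrier R" and mn: "coprime m (n::nat)"
    and "x [^] m \<in> F" "x [^] n \<in> F" "m \<noteq> 0"
  shows "x \<in> F"
proof (cases "x = \<zero>")
  case True then show ?thesis using subringE(2)[OF subfieldE(1)[OF F]] by simp
next
  case False
  obtain u v where uv: "m * u = n * v + 1"
    using bezout_nat[OF \<open>m \<noteq> 0\<close>, of n] mn by (auto simp: coprime_iff_gcd_eq_1)
  let ?y = "(x [^] n) [^] v"
  have y: "?y \<in> F - {\<zero>}"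
    using False x subfield_nat_pow[OF F assms(5)] by (simp add: nat_pow_nonzero)
  have "(x [^] m) [^] u = ?y \<otimes> x"
    using x uv by (simp add: nat_pow_pow)
  then have "?y \<otimes> x \<in> F" using subfield_nat_pow[OF F assms(4), of u] by simp
  moreover have "x = inv ?y \<otimes> (?y \<otimes> x)"
    using x y by (simp add: m_assoc[symmetric] field_Units)
  ultimately show ?thesis
    using subfield_m_inv(1)[OF F y] subringE(6)[OF subfieldE(1)[OF F]] by fastforce
qed

text \<open>
  Over a field \<open>F\<close> containing \<open>x\<^sup>p\<close>, the minimal polynomial \<open>f\<close> of \<open>x\<close> divides \<open>X\<^sup>p - x\<^sup>p = (X - x)\<^sup>p\<close>, so
  its constant term is \<open>(-x)\<^sup>m\<close> where \<open>m\<close> is its degree. If \<open>m < p\<close> then \<open>m\<close> is prime to \<open>p\<close>, and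
  from \<open>(-x)\<^sup>m\<close> and \<open>(-x)\<^sup>p\<close> in \<open>F\<close> a Bezout relation recovers \<open>x\<close> itself.
\<close>

lemma (in field) degree_of_pth_root:
  assumes p: "Factorial_Ring.prime (p::nat)" and char: "add_pow R p \<one> = \<zero>"
    and F: "subfield F R" and x: "x \<in> carrier R" and xp: "x [^] p \<in> F" and xF: "x \<notin> F"
  shows "(algebraic over F) x" and "degree (Irr F x) = p"
proof -
  let ?P = "poly_ring R" and ?l = "[\<one>, \<ominus> x]"
  interpret UP: domain ?P
    using univ_poly_is_domain[OF carrier_is_subring] .
  note sF = subfieldE(1)[OF F]
  have l: "?l \<in> carrier ?P"
    using x unfolding univ_poly_carrier[symmetric] polynomial_def by auto
  have p0: "0 < p" using p prime_gt_0_nat by blast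
  define q where "q = ?l [^]\<^bsub>?P\<^esub> p"
  interpret C: ring_hom_ring R ?P poly_of_const
    using canonical_embedding_ring_hom[OF carrier_is_subring] by simp
  have X: "X \<in> carrier ?P" using var_closed(1)[OF carrier_is_subring] .
  \<comment> \<open>Frobenius in the polynomial ring; the right-hand side shows that \<open>q\<close> has coefficients in \<open>F\<close>.\<close>
  have q_eq: "q = X [^]\<^bsub>?P\<^esub> p \<oplus>\<^bsub>?P\<^esub> poly_of_const ((\<ominus> x) [^] p)"
  proof -
    have "?l = X \<oplus>\<^bsub>?P\<^esub> poly_of_const (\<ominus> x)"
      using x by (auto simp: univ_poly_add poly_of_const_def var_def)
    moreover have "add_pow ?P p \<one>\<^bsub>?P\<^esub> = \<zero>\<^bsub>?P\<^esub>"
    proof -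
      have "add_pow ?P p (poly_of_const \<one>) = poly_of_const (add_pow R p \<one>)" 
        by (induction p) auto
      then show ?thesis using char by simp
    qed
    ultimately show ?thesis
      unfolding q_def using UP.frobenius_add[OF p] X x by (simp add: C.hom_nat_pow)
  qed
  have Xp: "X [^]\<^bsub>?P\<^esub> p = monom \<one> p" "X [^]\<^bsub>F[X]\<^esub> p = monom \<one> p"
    using unitary_monom_eq_var_pow[OF carrier_is_subring] unitary_monom_eq_var_pow[OF sF] by auto
  interpret E: ring_hom_ring ?P R "\<lambda>f. eval f x"
    using eval_ring_hom[OF carrier_is_subring x] .
  interpret Fr: ring_hom_ring R R "\<lambda>z. z [^] (p ^ 1)"
    using frobenius_hom[OF p char] .
  have mxp: "(\<ominus> x) [^] p \<in> F"
    using Fr.hom_a_inv[OF x] xp subringE(5)[OF sF] by simp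
  have qF: "q \<in> carrier (F[X])"
  proof -
    interpret UF: domain "F[X]"
      using univ_poly_is_domain[OF sF] .
    have "X [^]\<^bsub>F[X]\<^esub> p \<oplus>\<^bsub>F[X]\<^esub> poly_of_const ((\<ominus> x) [^] p) \<in> carrier (F[X])"
      using var_pow_closed[OF sF] ring_hom_memE(1)[OF canonical_embedding_is_hom[OF sF]] mxp
      by (intro UF.a_closed) auto
    then show ?thesis unfolding q_eq Xp by (simp add: univ_poly_add)
  qed
  have l0: "?l \<noteq> \<zero>\<^bsub>?P\<^esub>" unfolding univ_poly_zero by simp
  have q0: "q \<noteq> []"
    using UP.nat_pow_nonzero[OF l l0] unfolding q_def univ_poly_zero by blast
  have ev: "eval q x = \<zero>"
    unfolding q_def using l x p0 by (simp add: E.hom_nat_pow r_neg nat_pow_zero)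
  show alg: "(algebraic over F) x"
    using algebraicI[OF qF q0 ev] .
  let ?f = "Irr F x"
  note f = IrrE[OF F x alg]
  have f': "?f \<in> carrier ?P" using carrier_polynomial_shell[OF sF f(1)] .
  have "?f pdivides q" using Irr_minimal[OF F x alg qF ev] .
  then obtain g where g: "g \<in> carrier ?P" "q = ?f \<otimes>\<^bsub>?P\<^esub> g"
    unfolding pdivides_def factor_def by auto
  have "degree q = p"
  proof -
    have polys: "polynomial (carrier R) (monom \<one> p)"
        "polynomial (carrier R) (poly_of_const ((\<ominus> x) [^] p))"
      using UP.nat_pow_closed[OF X, of p] C.hom_closed x unfolding Xp univ_poly_carrier by auto
    have degs: "degree (monom \<one> p) = p" "degree (poly_of_const ((\<ominus> x) [^] p)) = 0"
      by (auto simp: monom_def poly_of_const_def)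
    then show ?thesis
      unfolding q_eq Xp univ_poly_add
      using poly_add_degree_eq[OF carrier_is_subring polys] p0 by (metis max_0R nat_neq_iff)
  qed
  then have le: "degree ?f \<le> p"
    using pdivides_imp_degree_le[OF sF f(1) qF q0 \<open>?f pdivides q\<close>] by simp
  have ge: "degree ?f \<ge> 1" using pirreducible_degree[OF F f(1,2)] .
  have "const_term ?f = (\<ominus> x) [^] degree ?f"
    using const_term_divisor_of_linear_power[OF x f' g(1), of p] g(2) f(3) x unfolding q_def by simp
  moreover have "const_term ?f \<in> F" using const_term_simprules_shell(1)[OF sF f(1)] .
  ultimately have m: "(\<ominus> x) [^] degree ?f \<in> F" by simp
  show "degree ?f = p"
  proof (rule ccontr)
    assume "degree ?f \<noteq> p"
    then have "\<not> p dvd degree ?f"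
      using le ge by (auto dest: dvd_imp_le)
    then have "coprime (degree ?f) p"
      using prime_imp_coprime[OF p] coprime_commute by blast
    then have "\<ominus> x \<in> F"
      using subfield_coprime_powers[OF F _ _ m mxp] x ge by simp
    then have "\<ominus> (\<ominus> x) \<in> F" using subringE(5)[OF sF] by blast
    then show False using xF x by simp
  qed
qed

section \<open>Adjunction as a closure operator\<close>

context field
begin

lemma adjoin_subfield:
  assumes "F \<subseteq> carrier R" "S \<subseteq> carrier R"
  shows "subfield (adjoin R F S) R"
  using assms unfolding adjoin_def by (intro generate_field_is_subfield) auto

lemma adjoin_in_carrier:
  assumes "F \<subseteq> carrier R" "S \<subseteq> carrier R"
  shows "adjoin R F S \<subseteq> carrier R"
  using subfieldE(3)[OF adjoin_subfield[OF assms]] .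

lemma adjoin_base: "F \<subseteq> adjoin R F S"
  and adjoin_gens: "S \<subseteq> adjoin R F S"
  unfolding adjoin_def by (auto intro: generate_field.incl)

lemma adjoin_least:
  assumes "subfield E R" "F \<subseteq> E" "S \<subseteq> E"
  shows "adjoin R F S \<subseteq> E"
proof -
  have "F \<union> S \<subseteq> carrier R" using assms subfieldE(3)[OF assms(1)] by blast
  then show ?thesis unfolding adjoin_def using assms by (intro generate_field_min_subfield1) auto
qed

lemma adjoin_mono:
  assumes "F \<subseteq> F'" "S \<subseteq> S'" "F' \<subseteq> carrier R" "S' \<subseteq> carrier R"
  shows "adjoin R F S \<subseteq> adjoin R F' S'"
  using assms adjoin_base[of F' S'] adjoin_gens[of S' F'] by (intro adjoin_least adjoin_subfield) auto

lemma adjoin_adjoin: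
  assumes "F \<subseteq> carrier R" "S \<subseteq> carrier R" "T \<subseteq> carrier R"
  shows "adjoin R (adjoin R F S) T = adjoin R F (S \<union> T)"
proof
  show "adjoin R (adjoin R F S) T \<subseteq> adjoin R F (S \<union> T)"
    using assms adjoin_gens[of "S \<union> T" F]
    by (intro adjoin_least[OF adjoin_subfield] adjoin_mono) auto
  show "adjoin R F (S \<union> T) \<subseteq> adjoin R (adjoin R F S) T"
    using assms adjoin_base[of "adjoin R F S" T] adjoin_base[of F S] adjoin_gens[of S F]
      adjoin_gens[of T "adjoin R F S"] adjoin_in_carrier[OF assms(1,2)]
    by (intro adjoin_least[OF adjoin_subfield]) auto
qed

lemma adjoin_absorb:
  assumes "subfield F R" "S \<subseteq> F"
  shows "adjoin R F S = F"
  using adjoin_least[OF assms(1) _ assms(2)] adjoin_base by blast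

lemma adjoin_finitary:
  assumes F: "F \<subseteq> carrier R" and S: "S \<subseteq> carrier R" and "z \<in> adjoin R F S"
  shows "\<exists>T. finite T \<and> T \<subseteq> S \<and> z \<in> adjoin R F T"
  using assms(3) unfolding adjoin_def
proof (induction rule: generate_field.induct)
  case one
  show ?case by (intro exI[of _ "{}"]) (auto intro: generate_field.one)
next
  case (incl h)
  then show ?case
    by (intro exI[of _ "if h \<in> F then {} else {h}"]) (auto intro: generate_field.incl)
next
  case (a_inv h)
  then show ?case by (blast intro: generate_field.a_inv)
next
  case (m_inv h)
  then show ?case by (blast intro: generate_field.m_inv)
next
  case (eng_add h1 h2)
  then obtain T1 T2 where T: "finite T1" "T1 \<subseteq> S" "h1 \<in> adjoin R F T1"
    "finite T2" "T2 \<subseteq> S" "h2 \<in> adjoin R F T2" unfolding adjoin_def by blast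
  moreover have "T1 \<union> T2 \<subseteq> carrier R" using T S by blast
  ultimately have "h1 \<in> adjoin R F (T1 \<union> T2)" "h2 \<in> adjoin R F (T1 \<union> T2)"
    using adjoin_mono[of F F T1 "T1 \<union> T2"] adjoin_mono[of F F T2 "T1 \<union> T2"] F S by auto
  then show ?case using T unfolding adjoin_def
    by (intro exI[of _ "T1 \<union> T2"]) (auto intro: generate_field.eng_add)
next
  case (eng_mult h1 h2)
  then obtain T1 T2 where T: "finite T1" "T1 \<subseteq> S" "h1 \<in> adjoin R F T1"
    "finite T2" "T2 \<subseteq> S" "h2 \<in> adjoin R F T2" unfolding adjoin_def by blast
  moreover have "T1 \<union> T2 \<subseteq> carrier R" using T S by blast
  ultimately have "h1 \<in> adjoin R F (T1 \<union> T2)" "h2 \<in> adjoin R F (T1 \<union> T2)"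
    using adjoin_mono[of F F T1 "T1 \<union> T2"] adjoin_mono[of F F T2 "T1 \<union> T2"] F S by auto
  then show ?case using T unfolding adjoin_def
    by (intro exI[of _ "T1 \<union> T2"]) (auto intro: generate_field.eng_mult)
qed

lemma simple_extension_eq_adjoin:
  assumes "subfield F R" "x \<in> carrier R" "(algebraic over F) x"
  shows "simple_extension F x = adjoin R F {x}"
proof
  note F = subfieldE(1,3)[OF assms(1)]
  show "simple_extension F x \<subseteq> adjoin R F {x}"
    using adjoin_subfield[of F "{x}"] F assms(2) adjoin_base[of F] adjoin_gens[of "{x}" F]
    by (intro simple_extension_subring_incl subfieldE(1)) auto
  show "adjoin R F {x} \<subseteq> simple_extension F x"
    using assms simple_extension_is_subfield simple_extension_incl[OF F(2)]
      simple_extension_mem[OF F(1)] by (intro adjoin_least) auto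
qed

end

section \<open>The exchange property\<close>

locale char_p_field = field R for R (structure) +
  fixes p :: nat
  assumes prime_p: "Factorial_Ring.prime p"
    and char_p: "add_pow R p \<one> = \<zero>"
begin

lemma subfield_roots:
  assumes F: "subfield F R"
  shows "subfield {z \<in> carrier R. z [^] (p ^ n) \<in> F} R"
proof (rule subfieldI')
  interpret h: ring_hom_ring R R "\<lambda>z. z [^] (p ^ n)"
    using frobenius_hom[OF prime_p char_p] .
  note sF = subfieldE(1)[OF F]
  show "subring {z \<in> carrier R. z [^] (p ^ n) \<in> F} R"
    by (rule subringI) (auto simp: subringE(3,5-7)[OF sF])
  fix z assume z: "z \<in> {z \<in> carrier R. z [^] (p ^ n) \<in> F} - {\<zero>}"
  then have "z \<in> Units R" and zc: "z \<in> carrier R" by (auto simp: field_Units)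
  then have iz: "inv z \<in> carrier R" "inv z \<otimes> z = \<one>" by auto
  then have "inv z [^] (p ^ n) \<otimes> z [^] (p ^ n) = \<one>"
    using zc by (metis h.hom_mult h.hom_one)
  then have "inv z [^] (p ^ n) = inv (z [^] (p ^ n))"
    using zc iz by (metis comm_inv_char m_comm nat_pow_closed)
  moreover have "inv (z [^] (p ^ n)) \<in> F"
    using subfield_m_inv(1)[OF F, of "z [^] (p ^ n)"] z nat_pow_nonzero[of z "p ^ n"] by auto
  ultimately show "inv z \<in> {z \<in> carrier R. z [^] (p ^ n) \<in> F}"
    using iz by simp
qed

text \<open>
  A purely inseparable extension generated by one \<open>p\<close>-th root has prime degree and therefore no proper
  intermediate field: if \<open>x\<close> were outside \<open>F(y)\<close>, the tower \<open>F \<subseteq> F(y) \<subseteq> F(x)\<close> would have two steps of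
  degree \<open>p\<close>, whereas \<open>F(x)\<close> has degree \<open>p\<close> over \<open>F\<close>.
\<close>

lemma pth_root_exchange_simple:
  assumes F: "subfield F R" and x: "x \<in> carrier R" "x [^] p \<in> F"
    and y: "y \<in> adjoin R F {x}" "y \<notin> F"
  shows "x \<in> adjoin R F {y}"
proof (rule ccontr)
  let ?E = "adjoin R F {y}"
  assume xE: "x \<notin> ?E"
  note Fc = subfieldE(3)[OF F]
  have "adjoin R F {x} \<subseteq> {z \<in> carrier R. z [^] (p ^ 1) \<in> F}"
    using x Fc subfield_nat_pow[OF F] by (intro adjoin_least subfield_roots[OF F]) auto
  then have yc: "y \<in> carrier R" and yp: "y [^] p \<in> F" using y(1) by auto
  have E: "subfield ?E R" using adjoin_subfield Fc yc by simp
  have xF: "x \<notin> F" and xpE: "x [^] p \<in> ?E" using xE adjoin_base[of F] x by auto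
  note dx = degree_of_pth_root[OF prime_p char_p F x xF]
    and dy = degree_of_pth_root[OF prime_p char_p F yc yp y(2)]
    and dxE = degree_of_pth_root[OF prime_p char_p E x(1) xpE xE]
  have d1: "dimension p F (adjoin R F {x})"
    using dimension_simple_extension[OF F x(1) dx(1)] dx simple_extension_eq_adjoin[OF F x(1)] by simp
  have d2: "dimension p F ?E"
    using dimension_simple_extension[OF F yc dy(1)] dy simple_extension_eq_adjoin[OF F yc] by simp
  have d3: "dimension p ?E (adjoin R F {x})"
  proof -
    have "adjoin R ?E {x} = adjoin R F {x}"
    proof -
      have "adjoin R ?E {x} = adjoin R F ({x} \<union> {y})"
        using adjoin_adjoin[OF Fc, of "{y}" "{x}"] x yc by (simp add: insert_commute)
      also have "\<dots> = adjoin R (adjoin R F {x}) {y}"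
        using adjoin_adjoin[OF Fc, of "{x}" "{y}"] x yc by simp
      also have "\<dots> = adjoin R F {x}"
        using adjoin_subfield[OF Fc, of "{x}"] x y(1) by (intro adjoin_absorb) auto
      finally show ?thesis .
    qed
    then show ?thesis
      using dimension_simple_extension[OF E x(1) dxE(1)] dxE simple_extension_eq_adjoin[OF E x(1)] by simp
  qed
  have "p * p = p"
    using dimension_is_inj[OF F telescopic_base[OF F E d2 d3] d1] .
  then show False using prime_gt_1_nat[OF prime_p] by simp
qed

text \<open>
  The exchange axiom of a matroid for the closure operator \<open>S \<mapsto> F(S)\<close>: the preceding lemma over the base
  field \<open>F(S)\<close>, which contains \<open>x\<^sup>p\<close> because \<open>F\<close> does.
\<close>

lemma pth_root_exchange:
  assumes F: "subfield F R" and S: "S \<subseteq> carrier R" and x: "x \<in> carrier R" "x [^] p \<in> F"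
    and y: "y \<in> adjoin R F (insert x S)" "y \<notin> adjoin R F S"
  shows "x \<in> adjoin R F (insert y S)"
proof -
  note Fc = subfieldE(3)[OF F]
  have yc: "y \<in> carrier R" using adjoin_in_carrier[OF Fc, of "insert x S"] S x y(1) by auto
  have "x \<in> adjoin R (adjoin R F S) {y}"
  proof (rule pth_root_exchange_simple[OF adjoin_subfield[OF Fc S] x(1) _ _ y(2)])
    show "x [^] p \<in> adjoin R F S" using x(2) adjoin_base by blast
    show "y \<in> adjoin R (adjoin R F S) {x}" using y(1) adjoin_adjoin[OF Fc S, of "{x}"] x(1) by simp
  qed
  then show ?thesis using adjoin_adjoin[OF Fc S, of "{y}"] yc by simp
qed

end

section \<open>Independent sets\<close>

definition r_independent :: "('a, 'b) ring_scheme \<Rightarrow> 'a set \<Rightarrow> 'a set \<Rightarrow> bool"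
  where "r_independent R F B \<longleftrightarrow> (\<forall>b\<in>B. b \<notin> adjoin R F (B - {b}))"

context field
begin

lemma r_independent_mono:
  assumes "r_independent R F' B'" "F \<subseteq> F'" "B \<subseteq> B'" "F' \<subseteq> carrier R" "B' \<subseteq> carrier R"
  shows "r_independent R F B"
  unfolding r_independent_def
proof
  fix b assume b: "b \<in> B"
  have "adjoin R F (B - {b}) \<subseteq> adjoin R F' (B' - {b})"
    using assms(2-5) by (intro adjoin_mono) auto
  then show "b \<notin> adjoin R F (B - {b})" using assms(1,3) b unfolding r_independent_def by blast
qed

end

context char_p_field
begin

text \<open>
  The usual matroid fact that a point outside the closure of an independent set can be added to it:
  otherwise exchange would put \<open>x\<close> into the closure of \<open>B\<close>.
\<close>

lemma r_independent_insert:
  assumes F: "subfield F R" and B: "B \<subseteq> carrier R" "r_independent R F B"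
    and x: "x \<in> carrier R" "x [^] p \<in> F" "x \<notin> adjoin R F B"
  shows "r_independent R F (insert x B)"
  unfolding r_independent_def
proof
  fix b assume "b \<in> insert x B"
  then consider "b = x" | "b \<in> B" "b \<noteq> x" by blast
  then show "b \<notin> adjoin R F (insert x B - {b})"
  proof cases
    case 1
    moreover have "x \<notin> B" using x(3) adjoin_gens by blast
    ultimately show ?thesis using x(3) by simp
  next
    case 2
    have eq: "insert x B - {b} = insert x (B - {b})" "insert b (B - {b}) = B" using 2 by auto
    have "b \<notin> adjoin R F (B - {b})" using B(2) 2 unfolding r_independent_def by blast
    then show ?thesis
      using pth_root_exchange[OF F _ x(1,2), of "B - {b}" b] x(3) B(1) unfolding eq by blast
  qed
qed

text \<open>
  Enlarging the base field by one \<open>p\<close>-th root contracts the matroid by one point, which lowers the rank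
  of an independent set by at most one. Indeed, a dependence of \<open>b\<close> over \<open>F(s)\<close> lets \<open>s\<close> stand in for
  \<open>b\<close>; a second dependence, among the elements left over, would place \<open>s\<close> in \<open>F(B - {b})\<close>, and then \<open>b\<close>
  would already be dependent over \<open>F\<close>.
\<close>

lemma r_independent_enlarge_base:
  assumes F: "subfield F R" and B: "B \<subseteq> carrier R" "r_independent R F B"
    and s: "s \<in> carrier R" "s [^] p \<in> F"
  shows "r_independent R (adjoin R F {s}) B \<or>
    (\<exists>b\<in>B. r_independent R (adjoin R F {s}) (B - {b}))"
proof (rule disjCI)
  note Fc = subfieldE(3)[OF F]
  have base: "adjoin R (adjoin R F {s}) T = adjoin R F (insert s T)" if "T \<subseteq> B" for T
    using adjoin_adjoin[OF Fc, of "{s}" T] s(1) that B(1) by auto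
  assume "\<not> (\<exists>b\<in>B. r_independent R (adjoin R F {s}) (B - {b}))"
  show "r_independent R (adjoin R F {s}) B"
  proof (rule ccontr)
    assume "\<not> r_independent R (adjoin R F {s}) B"
    then obtain b where b: "b \<in> B" "b \<in> adjoin R F (insert s (B - {b}))"
      unfolding r_independent_def by (auto simp: base)
    moreover have "\<not> r_independent R (adjoin R F {s}) (B - {b})"
      using b(1) \<open>\<not> (\<exists>b\<in>B. _ b)\<close> by blast
    ultimately obtain c where c: "c \<in> B - {b}" "c \<in> adjoin R (adjoin R F {s}) (B - {b} - {c})"
      unfolding r_independent_def by blast
    have "B - {b} - {c} \<subseteq> B" by blast
    note c = c(1) c(2)[unfolded base[OF this]]
    \<comment> \<open>From here on \<open>s\<close> is shown to lie in \<open>F(B - {b})\<close>, which makes \<open>b\<close> dependent on \<open>B - {b}\<close>.\<close>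
    have "adjoin R F (B - {b} - {c}) \<subseteq> adjoin R F (B - {c})"
      using B(1) Fc by (intro adjoin_mono) auto
    then have "c \<notin> adjoin R F (B - {b} - {c})"
      using B(2) c(1) unfolding r_independent_def by blast
    then have "s \<in> adjoin R F (insert c (B - {b} - {c}))"
      using pth_root_exchange[OF F _ s _ , of "B - {b} - {c}" c] c(2) B(1) by blast
    moreover have "insert c (B - {b} - {c}) = B - {b}" using c(1) by blast
    ultimately have "insert s (B - {b}) \<subseteq> adjoin R F (B - {b})"
      using adjoin_gens by auto
    then have "adjoin R F (insert s (B - {b})) \<subseteq> adjoin R F (B - {b})"
      using B(1) Fc adjoin_base by (intro adjoin_least adjoin_subfield) auto
    then show False using b B(2) unfolding r_independent_def by blast
  qed
qed

text \<open>
  Steinitz' comparison of independent and generating sets. The generators are moved one at a time into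
  the base field, each of them costing at most one element of the independent set.
\<close>

lemma r_independent_card_le_generators:
  assumes "finite S" "subfield F R" "S \<subseteq> carrier R" "\<And>s. s \<in> S \<Longrightarrow> s [^] p \<in> F"
    and "r_independent R F B" "B \<subseteq> adjoin R F S"
  shows "finite B \<and> card B \<le> card S"
  using assms
proof (induction S arbitrary: F B rule: finite_induct)
  case empty
  have "adjoin R F {} = F" using adjoin_absorb[OF empty.prems(1)] by simp
  then have "B = {}"
    using empty.prems(4,5) adjoin_base unfolding r_independent_def by blast
  then show ?case by simp
next
  case (insert s S)
  note Fc = subfieldE(3)[OF insert.prems(1)]
  let ?F = "adjoin R F {s}"
  have F': "subfield ?F R" using adjoin_subfield[OF Fc] insert.prems(2) by simp
  have B: "B \<subseteq> carrier R" using insert.prems(5) adjoin_in_carrier[OF Fc insert.prems(2)] by blast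
  have IH: "finite B' \<and> card B' \<le> card S" if "r_independent R ?F B'" "B' \<subseteq> B" for B'
  proof (rule insert.IH[OF F'])
    show "B' \<subseteq> adjoin R ?F S"
      using that(2) insert.prems(2,5) adjoin_adjoin[OF Fc, of "{s}" S] by auto
  qed (use that insert.prems adjoin_base[of F "{s}"] in auto)
  from r_independent_enlarge_base[OF insert.prems(1) B insert.prems(4)] insert.prems(2,3)
  consider "r_independent R ?F B" | b where "b \<in> B" "r_independent R ?F (B - {b})" by blast
  then show ?case
  proof cases
    case 1
    then show ?thesis using IH[of B] insert.hyps by simp
  next
    case 2
    then have "finite (B - {b}) \<and> card (B - {b}) \<le> card S" using IH[of "B - {b}"] by blast
    then show ?thesis using 2(1) insert.hyps by (auto simp: card_Diff_singleton_if)
  qed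
qed

section \<open>Transport of independent sets to larger fields\<close>

text \<open>
  The field \<open>k(L\<^sup>p)\<close>, over which an \<open>r\<close>-base of \<open>L/k\<close> is independent and generates \<open>L\<close>.
\<close>

definition r_ground :: "'a set \<Rightarrow> 'a set \<Rightarrow> 'a set"
  where "r_ground k L = adjoin R k ((\<lambda>x. x [^] p) ` L)"

lemma r_ground_mono:
  assumes "k \<subseteq> carrier R" "L \<subseteq> L'" "L' \<subseteq> carrier R"
  shows "r_ground k L \<subseteq> r_ground k L'"
  using assms unfolding r_ground_def by (intro adjoin_mono) auto

lemma r_ground_subfield:
  assumes "k \<subseteq> carrier R" "L \<subseteq> carrier R"
  shows "subfield (r_ground k L) R"
  using assms unfolding r_ground_def by (intro adjoin_subfield) auto

lemma r_ground_subset: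
  assumes "subfield L R" "k \<subseteq> L"
  shows "r_ground k L \<subseteq> L"
  using assms subfield_nat_pow[OF assms(1)] unfolding r_ground_def by (intro adjoin_least) auto

lemma power_in_r_ground: "x \<in> L \<Longrightarrow> x [^] p \<in> r_ground k L"
  unfolding r_ground_def by (rule subsetD[OF adjoin_gens imageI])

text \<open>
  The passage from \<open>L\<close> to a larger field \<open>M\<close> does not preserve \<open>r\<close>-independence of a given set, because the
  ground field grows from \<open>k(L\<^sup>p)\<close> to \<open>k(M\<^sup>p)\<close>; only the attainable cardinalities survive. Hence the
  formulation with a second set \<open>D\<close>, which has the advantage of composing along a tower of fields.
\<close>

definition carries_r_independence :: "'a set \<Rightarrow> 'a set \<Rightarrow> 'a set \<Rightarrow> bool"
  where "carries_r_independence k L M \<longleftrightarrow>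
    (\<forall>C. finite C \<and> C \<subseteq> L \<and> r_independent R (r_ground k L) C \<longrightarrow>
      (\<exists>D. finite D \<and> D \<subseteq> M \<and> r_independent R (r_ground k M) D \<and> card D = card C))"

lemma carries_refl: "carries_r_independence k L L"
  unfolding carries_r_independence_def by blast

lemma carries_trans:
  assumes "carries_r_independence k L M" "carries_r_independence k M N"
  shows "carries_r_independence k L N"
  using assms unfolding carries_r_independence_def by metis

text \<open>
  The heart of the argument. Passing from \<open>L\<close> to \<open>M = L(x)\<close> enlarges the ground field \<open>k(L\<^sup>p)\<close> at most by the
  single element \<open>x\<^sup>p\<close>, which costs at most one element \<open>c\<close> of an independent set \<open>C\<close>. If \<open>c\<close> is lost, then
  \<open>x\<close> replaces it: the field generated by \<open>C - {c}\<close> over \<open>k(L\<^sup>p)(x\<^sup>p)\<close> lies in \<open>L\<close>, whereas \<open>x\<close> does not.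
\<close>

lemma carries_adjoin_pth_root:
  assumes L: "subfield L R" and k: "k \<subseteq> L" and x: "x \<in> carrier R" "x [^] p \<in> L"
  shows "carries_r_independence k L (adjoin R L {x})"
proof (cases "x \<in> L")
  case True
  then have "adjoin R L {x} = L" using adjoin_absorb[OF L] by simp
  then show ?thesis using carries_refl by simp
next
  case False
  note Lc = subfieldE(3)[OF L]
  let ?M = "adjoin R L {x}" and ?F = "r_ground k L"
  let ?F' = "adjoin R ?F {x [^] p}"
  have kc: "k \<subseteq> carrier R" using k Lc by blast
  have F: "subfield ?F R" using r_ground_subfield[OF kc Lc] .
  note Fc = subfieldE(3)[OF F]
  have F': "subfield ?F' R" using adjoin_subfield[OF Fc] x(1) by simp
  have F'L: "?F' \<subseteq> L"
    using adjoin_least[OF L r_ground_subset[OF L k]] x(2) by simp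
  have "?M \<subseteq> {z \<in> carrier R. z [^] (p ^ 1) \<in> ?F'}"
  proof (intro adjoin_least subfield_roots[OF F'])
    show "L \<subseteq> {z \<in> carrier R. z [^] (p ^ 1) \<in> ?F'}"
      using Lc subsetD[OF adjoin_base power_in_r_ground, of _ L k] by auto
    show "{x} \<subseteq> {z \<in> carrier R. z [^] (p ^ 1) \<in> ?F'}"
      using x(1) adjoin_gens[of "{x [^] p}"] by auto
  qed
  then have Mp: "(\<lambda>z. z [^] p) ` ?M \<subseteq> ?F'" by auto
  have "k \<subseteq> ?F" unfolding r_ground_def by (rule adjoin_base)
  then have "k \<subseteq> ?F'" using adjoin_base[of ?F] by blast
  then have FM: "r_ground k ?M \<subseteq> ?F'"
    unfolding r_ground_def[of k ?M] by (rule adjoin_least[OF F' _ Mp])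
  show ?thesis
    unfolding carries_r_independence_def
  proof (intro allI impI, elim conjE)
    fix C assume C: "finite C" "C \<subseteq> L" "r_independent R ?F C"
    have down: "r_independent R (r_ground k ?M) D" if "r_independent R ?F' D" "D \<subseteq> ?M" for D
      using r_independent_mono[OF that(1) FM order.refl subfieldE(3)[OF F']]
        that(2) adjoin_in_carrier[OF Lc, of "{x}"] x(1) by auto
    have Cc: "C \<subseteq> carrier R" using C(2) Lc by blast
    from r_independent_enlarge_base[OF F Cc C(3), of "x [^] p"] x power_in_r_ground
    consider "r_independent R ?F' C" | c where "c \<in> C" "r_independent R ?F' (C - {c})" by auto
    then show "\<exists>D. finite D \<and> D \<subseteq> ?M \<and> r_independent R (r_ground k ?M) D \<and> card D = card C"
    proof cases
      case 1
      then show ?thesis using C down[of C] adjoin_base[of L] by blast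
    next
      case 2
      let ?D = "insert x (C - {c})"
      have "adjoin R ?F' (C - {c}) \<subseteq> L" by (rule adjoin_least[OF L F'L]) (use C(2) in blast)
      then have "x \<notin> adjoin R ?F' (C - {c})" using False by blast
      then have "r_independent R ?F' ?D"
        using x(1) adjoin_gens[of "{x [^] p}"] Cc 2(2) by (intro r_independent_insert[OF F']) auto
      moreover have "?D \<subseteq> ?M" using C(2) adjoin_base[of L "{x}"] adjoin_gens[of "{x}" L] by blast
      moreover have "card ?D = card C"
      proof -
        have "x \<notin> C - {c}" using False C(2) by blast
        then show ?thesis using card_Suc_Diff1[OF C(1) 2(1)] C(1) by simp
      qed
      ultimately show ?thesis using down[of ?D] C(1) by (intro exI[of _ ?D]) simp
    qed
  qed
qed

text \<open>
  The extension \<open>L(x)/L\<close> is climbed through the fields \<open>L(x\<^bsup>p^j\<^esup>)\<close> with \<open>j\<close> decreasing to \<open>0\<close>; each is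
  generated over the preceding one by a \<open>p\<close>-th root.
\<close>

lemma carries_adjoin_root:
  assumes "subfield L R" "k \<subseteq> L" "x \<in> carrier R" "x [^] (p ^ n) \<in> L"
  shows "carries_r_independence k L (adjoin R L {x})"
  using assms
proof (induction n arbitrary: L)
  case 0
  then have "adjoin R L {x} = L" using adjoin_absorb[of L "{x}"] by simp
  then show ?case using carries_refl by simp
next
  case (Suc n)
  let ?y = "x [^] (p ^ n)"
  let ?L' = "adjoin R L {?y}"
  note Lc = subfieldE(3)[OF Suc.prems(1)]
  have y: "?y \<in> carrier R" "?y [^] p \<in> L"
    using Suc.prems(3,4) by (auto simp: nat_pow_pow mult.commute)
  have L': "subfield ?L' R" using adjoin_subfield[OF Lc] y by simp
  have "carries_r_independence k ?L' (adjoin R ?L' {x})"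
    using Suc.prems L' adjoin_base[of L] adjoin_gens[of "{?y}"] by (intro Suc.IH) auto
  moreover have "adjoin R ?L' {x} = adjoin R L {x}"
  proof -
    have M: "subfield (adjoin R L {x}) R" using adjoin_subfield[OF Lc] Suc.prems(3) by simp
    have "x \<in> adjoin R L {x}" using adjoin_gens by blast
    then have "?y \<in> adjoin R L {x}" using subfield_nat_pow[OF M] by blast
    moreover have "adjoin R ?L' {x} = adjoin R (adjoin R L {x}) {?y}"
      using adjoin_adjoin[OF Lc, of "{?y}" "{x}"] adjoin_adjoin[OF Lc, of "{x}" "{?y}"] y Suc.prems(3)
      by (simp add: insert_commute)
    ultimately show ?thesis using adjoin_absorb[OF M] by simp
  qed
  ultimately show ?case
    using carries_trans carries_adjoin_pth_root[OF Suc.prems(1,2) y] by metis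
qed

lemma carries_adjoin_finite:
  assumes "finite S" "subfield L R" "k \<subseteq> L" "S \<subseteq> carrier R" "\<And>s. s \<in> S \<Longrightarrow> s [^] (p ^ n) \<in> L"
  shows "carries_r_independence k L (adjoin R L S)"
  using assms
proof (induction S arbitrary: L rule: finite_induct)
  case empty
  then have "adjoin R L {} = L" using adjoin_absorb[of L "{}"] by simp
  then show ?case using carries_refl by simp
next
  case (insert s S)
  let ?L' = "adjoin R L {s}"
  note Lc = subfieldE(3)[OF insert.prems(1)]
  have "carries_r_independence k ?L' (adjoin R ?L' S)"
    using insert.prems adjoin_subfield[OF Lc] adjoin_base[of L "{s}"] by (intro insert.IH) auto
  moreover have "adjoin R ?L' S = adjoin R L (insert s S)"
    using adjoin_adjoin[OF Lc, of "{s}" S] insert.prems(3) by simp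
  moreover have "carries_r_independence k L ?L'"
    using insert.prems by (intro carries_adjoin_root[of _ _ _ n]) auto
  ultimately show ?case using carries_trans by metis
qed

text \<open>
  The theorem for finitely many generators. An independent set for \<open>L/k\<close> is carried to one of the same size
  for \<open>M = k(S)\<close>, where \<open>S\<close> itself generates \<open>M\<close> over \<open>k(M\<^sup>p)\<close>, so Steinitz' comparison applies.
  The finite subsets \<open>C\<close> of \<open>B\<close> are treated separately, as \<open>B\<close> is not known to be finite beforehand.
\<close>

lemma r_independent_card_le:
  assumes k: "k \<subseteq> carrier R" and L: "subfield L R" "k \<subseteq> L"
    and S: "finite S" "S \<subseteq> carrier R" "\<And>s. s \<in> S \<Longrightarrow> s [^] (p ^ n) \<in> k"
    and LS: "L \<subseteq> adjoin R k S"
    and B: "B \<subseteq> L" "r_independent R (r_ground k L) B"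
  shows "finite B \<and> card B \<le> card S"
proof -
  let ?M = "adjoin R k S"
  note Lc = subfieldE(3)[OF L(1)]
  have M: "subfield ?M R" using adjoin_subfield[OF k S(2)] .
  have Mc: "?M \<subseteq> carrier R" using subfieldE(3)[OF M] .
  have "adjoin R L S = ?M"
    using L(2) LS adjoin_gens[of S k] adjoin_mono[of k L S S] Lc S(2)
    by (intro equalityI adjoin_least[OF M]) auto
  then have carries: "carries_r_independence k L ?M"
    using carries_adjoin_finite[OF S(1) L(1,2) S(2), of n] S(3) L(2) by auto
  let ?F = "r_ground k ?M"
  have F: "subfield ?F R" using r_ground_subfield[OF k Mc] .
  have MF: "?M \<subseteq> adjoin R ?F S"
    using subfieldE(3)[OF F] S(2) adjoin_base[of k] unfolding r_ground_def by (intro adjoin_mono) auto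
  have bound: "card C \<le> card S" if C: "finite C" "C \<subseteq> B" for C
  proof -
    have "r_independent R (r_ground k L) C"
      using r_independent_mono[OF B(2) order.refl C(2)] r_ground_subset[OF L] Lc B(1) by blast
    then obtain D where D: "finite D" "D \<subseteq> ?M" "r_independent R ?F D" "card D = card C"
      using carries[unfolded carries_r_independence_def, rule_format, of C]
        C(1) order.trans[OF C(2) B(1)] by auto
    have roots: "s [^] p \<in> ?F" if "s \<in> S" for s
      using that by (intro power_in_r_ground subsetD[OF adjoin_gens])
    have "card D \<le> card S"
      using r_independent_card_le_generators[OF S(1) F S(2) _ D(3) order.trans[OF D(2) MF]]
        roots by blast
    then show ?thesis using D(4) by simp
  qed
  then show ?thesis by (intro finite_if_finite_subsets_card_bdd) auto
qed

section \<open>Comparison of cardinalities\<close>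

text \<open>
  Finite exponent is what makes an \<open>r\<close>-base generate \<open>K\<close> over \<open>k\<close> itself. Put \<open>M = k(B)\<close>, so that
  \<open>K = M(K\<^sup>p)\<close>. If all \<open>p ^ (n + 1)\<close>-th powers lie in \<open>M\<close>, then the elements whose \<open>p ^ n\<close>-th power lies in \<open>M\<close>
  form a subfield containing \<open>M\<close> and \<open>K\<^sup>p\<close>, hence all of \<open>K\<close>; descending to \<open>n = 0\<close> gives \<open>K = M\<close>.
\<close>

lemma generated_by_r_generators:
  assumes k: "k \<subseteq> carrier R" and B: "B \<subseteq> carrier R"
    and gen: "carrier R = adjoin R (r_ground k (carrier R)) B"
    and exponent: "\<And>x. x \<in> carrier R \<Longrightarrow> x [^] (p ^ n) \<in> k"
  shows "carrier R = adjoin R k B"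
proof -
  let ?M = "adjoin R k B"
  have M: "subfield ?M R" using adjoin_subfield[OF k B] .
  have "\<forall>x\<in>carrier R. x [^] (p ^ n) \<in> ?M" using exponent adjoin_base by blast
  then have "\<forall>x\<in>carrier R. x [^] (p ^ 0) \<in> ?M"
  proof (induction n)
    case (Suc n)
    let ?E = "{z \<in> carrier R. z [^] (p ^ n) \<in> ?M}"
    have E: "subfield ?E R" using subfield_roots[OF M] .
    have M_E: "?M \<subseteq> ?E" using subfieldE(3)[OF M] subfield_nat_pow[OF M] by blast
    have "x [^] p \<in> ?E" if "x \<in> carrier R" for x
      using Suc.prems that by (simp add: nat_pow_pow)
    then have "r_ground k (carrier R) \<subseteq> ?E"
      unfolding r_ground_def using M_E adjoin_base[of k] by (intro adjoin_least[OF E]) auto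
    then have "carrier R \<subseteq> ?E"
      using M_E adjoin_gens[of B] by (subst gen) (intro adjoin_least[OF E], auto)
    then show ?case by (intro Suc.IH) blast
  qed
  then show ?thesis using subfieldE(3)[OF M] by auto
qed

text \<open>
  For infinite \<open>B\<close>, every element of \<open>C\<close> lies in \<open>k(S)\<close> for a finite \<open>S \<subseteq> B\<close>, and each \<open>C \<inter> k(S)\<close> is finite
  by the finite case applied to the intermediate field \<open>L \<inter> k(S)\<close>. As \<open>B\<close> has only \<open>|B|\<close> finite subsets, \<open>C\<close>
  is a union of \<open>|B|\<close> finite sets.
\<close>

lemma card_of_r_independent_le_generators:
  assumes k: "k \<subseteq> carrier R" and B: "B \<subseteq> carrier R" "carrier R = adjoin R k B"
    and exponent: "\<And>x. x \<in> carrier R \<Longrightarrow> x [^] (p ^ n) \<in> k"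
    and L: "subfield L R" "k \<subseteq> L" and C: "C \<subseteq> L" "r_independent R (r_ground k L) C"
  shows "|C| \<le>o |B|"
proof (cases "finite B")
  case True
  have "finite C \<and> card C \<le> card B"
    using r_independent_card_le[OF k L True B(1) _ _ C] exponent B subfieldE(3)[OF L(1)] by blast
  then show ?thesis using True finite_card_of_iff_card2 by blast
next
  case False
  have local_le: "finite (C \<inter> adjoin R k S)" if S: "finite S" "S \<subseteq> B" for S
  proof -
    let ?M = "L \<inter> adjoin R k S"
    have Sc: "S \<subseteq> carrier R" using S(2) B(1) by blast
    have M: "subfield ?M R"
    proof -
      have "subring ?M R"
        using subring_inter subfieldE(1)[OF L(1)] subfieldE(1)[OF adjoin_subfield[OF k Sc]] by blast
      then show ?thesis
        using subfield_m_inv(1)[OF L(1)] subfield_m_inv(1)[OF adjoin_subfield[OF k Sc]]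
        by (intro subfieldI') auto
    qed
    have ind: "r_independent R (r_ground k ?M) (C \<inter> adjoin R k S)"
      using r_independent_mono[OF C(2) r_ground_mono[OF k, of ?M L]] subfieldE(3)[OF L(1)] C(1)
        r_ground_subset[OF L] by blast
    show ?thesis
      using r_independent_card_le[OF k M _ S(1) Sc _ _ _ ind] L(2) C(1) exponent Sc adjoin_base[of k S]
      by blast
  qed
  have "C \<subseteq> (\<Union>S\<in>Fpow B. C \<inter> adjoin R k S)"
  proof
    fix c assume c: "c \<in> C"
    then have "c \<in> adjoin R k B" using C(1) subfieldE(3)[OF L(1)] B(2) by blast
    then show "c \<in> (\<Union>S\<in>Fpow B. C \<inter> adjoin R k S)"
      using adjoin_finitary[OF k B(1)] c unfolding Fpow_def by auto
  qed
  then have "|C| \<le>o |\<Union>S\<in>Fpow B. C \<inter> adjoin R k S|" by (rule card_of_mono1)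
  also have "|\<Union>S\<in>Fpow B. C \<inter> adjoin R k S| \<le>o |B|"
  proof (rule card_of_UNION_ordLeq_infinite[OF False])
    show "|Fpow B| \<le>o |B|" using card_of_Fpow_infinite[OF False] ordIso_imp_ordLeq by blast
    show "\<forall>S\<in>Fpow B. |C \<inter> adjoin R k S| \<le>o |B|"
    proof
      fix S assume "S \<in> Fpow B"
      then have "finite (C \<inter> adjoin R k S)" using local_le unfolding Fpow_def by blast
      then show "|C \<inter> adjoin R k S| \<le>o |B|"
        using False card_of_ordLeq_infinite card_of_ordLeq_finite ordLeq_total card_of_Well_order by blast
    qed
  qed
  finally show ?thesis .
qed

end

section \<open>The characteristic of a field\<close>

lemma (in field) ring_char_prime:
  assumes "ring_char R > 0"
  shows "Factorial_Ring.prime (ring_char R)" "add_pow R (ring_char R) \<one> = \<zero>"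
proof -
  have dvd: "add_pow R n \<one> = \<zero> \<longleftrightarrow> ring_char R dvd n" for n :: nat
    using add.pow_eq_id[of \<one> n] unfolding ring_char_def by simp
  show "add_pow R (ring_char R) \<one> = \<zero>" using dvd by simp
  show "Factorial_Ring.prime (ring_char R)"
    unfolding prime_nat_iff
  proof (intro conjI allI impI)
    have "ring_char R \<noteq> 1" using dvd[of 1] by simp
    then show "1 < ring_char R" using assms by simp
    fix m assume "m dvd ring_char R"
    then obtain l where l: "ring_char R = m * l" by blast
    have "add_pow R m \<one> \<otimes> add_pow R l \<one> = add_pow R (m * l) \<one>"
      by (simp add: add_pow_ldistr add_pow_rdistr add.nat_pow_pow mult.commute)
    then have "add_pow R m \<one> = \<zero> \<or> add_pow R l \<one> = \<zero>"
      using dvd[of "m * l"] l integral by simp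
    then have "m * l dvd m \<or> m * l dvd l" using dvd l by simp
    then show "m = 1 \<or> m = ring_char R" using assms l by auto
  qed
qed

lemma (in field) ring_char_subfield:
  assumes "subfield L R"
  shows "ring_char (R\<lparr>carrier := L\<rparr>) = ring_char R"
proof -
  interpret L: field "R\<lparr>carrier := L\<rparr>" using subfield_iff(2)[OF assms] .
  have "add_pow (R\<lparr>carrier := L\<rparr>) n \<one> = add_pow R n \<one>" for n :: nat
    unfolding add_pow_def by (simp add: nat_pow_def)
  then have "ring_char R dvd n \<longleftrightarrow> ring_char (R\<lparr>carrier := L\<rparr>) dvd n" for n
    using add.pow_eq_id[of \<one> n] L.add.pow_eq_id[of \<one> n] subringE(3)[OF subfieldE(1)[OF assms]]
    unfolding ring_char_def by simp
  then show ?thesis by (meson dvd_antisym dvd_refl)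
qed

section \<open>The rank of an intermediate field\<close>

theorem mainTheorem1:
  fixes K :: "('a, 'b) ring_scheme" and k L B\<^sub>L B\<^sub>K :: "'a set"
  assumes "field K"
    and "ring_char K > 0"
    and "subfield k K"
    and "purely_inseparable K k"
    and "finite_exponent K k"
    and "subfield L K" and "k \<subseteq> L"
    and "r_base (K\<lparr>carrier := L\<rparr>) k B\<^sub>L"
    and "r_base K k B\<^sub>K"
  shows "|B\<^sub>L| \<le>o |B\<^sub>K|"
proof -
  interpret field K by fact
  interpret char_p_field K "ring_char K"
    using ring_char_prime[OF assms(2)] by unfold_locales
  let ?p = "ring_char K"
  have kc: "k \<subseteq> carrier K" using assms(3) subfieldE(3) by auto
  obtain e where "power_image K (?p ^ e) \<subseteq> k" using assms(5) unfolding finite_exponent_def by blast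
  then have e: "x [^]\<^bsub>K\<^esub> (?p ^ e) \<in> k" if "x \<in> carrier K" for x
    using that unfolding power_image_def by blast
  have BK: "B\<^sub>K \<subseteq> carrier K" "carrier K = adjoin K (r_ground k (carrier K)) B\<^sub>K"
    using assms(9) unfolding r_base_def r_ground_def power_image_def by auto
  have adj: "adjoin (K\<lparr>carrier := L\<rparr>) F S = adjoin K F S" if "F \<subseteq> L" "S \<subseteq> L" for F S
    using subfield_gen_equality[OF assms(6)] that unfolding adjoin_def by simp
  have "power_image (K\<lparr>carrier := L\<rparr>) ?p = (\<lambda>x. x [^]\<^bsub>K\<^esub> ?p) ` L"
    unfolding power_image_def by (simp add: nat_pow_def)
  then have ground: "adjoin (K\<lparr>carrier := L\<rparr>) k (power_image (K\<lparr>carrier := L\<rparr>) ?p) = r_ground k L"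
    using adj[OF assms(7), of "(\<lambda>x. x [^]\<^bsub>K\<^esub> ?p) ` L"] subfield_nat_pow[OF assms(6)]
    unfolding r_ground_def by auto
  have BL: "B\<^sub>L \<subseteq> L" using assms(8) unfolding r_base_def by simp
  have "r_independent K (r_ground k L) B\<^sub>L"
    unfolding r_independent_def
  proof
    fix x assume "x \<in> B\<^sub>L"
    moreover have "adjoin (K\<lparr>carrier := L\<rparr>) (r_ground k L) (B\<^sub>L - {x}) = adjoin K (r_ground k L) (B\<^sub>L - {x})"
      using adj r_ground_subset[OF assms(6,7)] BL by blast
    ultimately show "x \<notin> adjoin K (r_ground k L) (B\<^sub>L - {x})"
      using assms(8) unfolding r_base_def ring_char_subfield[OF assms(6)] ground by auto
  qed
  then show ?thesis
    using card_of_r_independent_le_generators[OF kc BK(1) generated_by_r_generators[OF kc BK e] e assms(6,7) BL]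
    by blast
qed

end
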